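(* Let $\mathbb{K}\in\{\mathbb{R},\mathbb{C}\}$ and let $G=(V,E)$ be a connected, locally finite, simplicial, undirected graph with countably infinite vertex set $V=\{v_k : k\in\mathbb{N}\}$, where $v_k\neq v_j$ for $k\neq j$. Let $\omega$ denote $\mathbb{K}^{\mathbb{N}}$ equipped with the product topology. Then for every $\lambda\in\mathbb{K}$ and every quasiadjacency matrix $B$ with respect to $G$, the continuous linear operator $\lambda\,\mathrm{Id}-B$ on $\omega$ does not generate a strongly continuous semigroup on $\omega$. In particular, for any choice of positive weights $\gamma_{v,w}>0$ (for $v,w\in V$ with $v\sim w$), with associated graph Laplacian $\Delta_G f(v)=\sum_{w\sim v}\gamma_{v,w}\,(f(v)-f(w))$, and for all $\alpha,\beta\in\mathbb{K}$ with $\beta\neq 0$, the operator $\alpha\,\mathrm{Id}+\beta\Delta_G$ is not the generator of a strongly continuous semigroup on $\mathbb{K}^V$ equipped with the product topology.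
   Context: Graphs: $G=(V,E)$ with $E\subseteq V\times V$; $v\sim w$ ($v$ and $w$ are adjacent) means $(v,w)\in E$. $G$ is undirected if $(v,w)\in E$ implies $(w,v)\in E$; simplicial if it has no multiple edges (automatic from $E\subseteq V\times V$) and no loops, i.e. $(v,v)\notin E$ for all $v\in V$; locally finite if every vertex has only finitely many adjacent vertices; connected if any two different vertices are joined by a path, i.e. by a finite sequence of edges $(w_0,w_1),\dots,(w_{n-1},w_n)$. Graph Laplacian: given weights $\gamma_{v,w}>0$ for all pairs $v\sim w$ (not assumed symmetric in $v,w$), $\Delta_G\colon\mathbb{K}^V\to\mathbb{K}^V$ is the linear operator $\Delta_G f(v)=\sum_{w\sim v}\gamma_{v,w}(f(v)-f(w))$, $v\in V$. Quasiadjacency matrix: a matrix $B=(b_{k,l})\in\mathbb{K}^{\mathbb{N}\times\mathbb{N}}$ is called a quasiadjacency matrix with respect to $G$ (and the fixed enumeration $(v_k)_{k\in\mathbb{N}}$ of $V$) if there is $c\in\mathbb{K}$, $c\neq 0$, such that $c\,b_{k,l}\geq 0$ (in particular real) for all $k,l\in\mathbb{N}$, and $b_{k,l}\neq 0$ precisely when $v_k$ and $v_l$ are adjacent. Such a $B$ acts on $\omega$ by $(Bf)_k=\sum_{l}b_{k,l}f_l$, a finite sum for each $k$ by local finiteness. Semigroups: a strongly continuous semigroup on a locally convex space $X$ is a family $(T_t)_{t\geq 0}$ of continuous linear operators on $X$ with $T_0=\mathrm{Id}$, $T_{s+t}=T_s\circ T_t$ for all $s,t\geq 0$, and such that for each $x\in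 X$ the orbit $[0,\infty)\to X$, $t\mapsto T_t(x)$, is continuous. Its generator is the operator $Ax=\lim_{t\downarrow 0}\frac{1}{t}(T_t x-x)$, with domain the set of all $x\in X$ for which this limit exists in $X$. A continuous linear operator $A\colon X\to X$ generates a strongly continuous semigroup if there is a strongly continuous semigroup on $X$ whose generator is $A$ (with domain all of $X$). *)

theory Defs
  imports "HOL-Analysis.Analysis" "HOL-Library.Function_Algebras"
begin

text \<open>
  The scalar field of a topological vector space is a type \<open>'k\<close> of class
  \<open>real_normed_field\<close>, to be instantiated to \<open>real\<close> and \<open>complex\<close>. Functions carry no
  \<open>real_vector\<close> instance in the library, so the scalar multiplication \<open>scl\<close> of the space is
  an explicit parameter, as in \<^locale>\<open>vector_space\<close>. For the spaces \<open>'i \<Rightarrow> 'k\<close> the addition is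
  the pointwise one of \<open>Function_Algebras\<close> and the topology is the product topology of
  \<open>Function_Topology\<close>.
\<close>

definition fun_scale :: "'k::field \<Rightarrow> ('i \<Rightarrow> 'k) \<Rightarrow> ('i \<Rightarrow> 'k)" where
  "fun_scale c f = (\<lambda>i. c * f i)"

lemma vector_space_fun_scale: "vector_space (fun_scale :: 'k::field \<Rightarrow> ('i \<Rightarrow> 'k) \<Rightarrow> ('i \<Rightarrow> 'k))"
  by unfold_locales (auto simp: fun_scale_def algebra_simps)

text \<open>The values of \<open>T t\<close> for \<open>t < 0\<close> are irrelevant.\<close>

definition strongly_continuous_semigroup ::
  "('k::real_normed_field \<Rightarrow> 'x \<Rightarrow> 'x::{ab_group_add, topological_space}) \<Rightarrow> (real \<Rightarrow> 'x \<Rightarrow> 'x) \<Rightarrow> bool"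
  where
  "strongly_continuous_semigroup scl T \<longleftrightarrow>
     (\<forall>t\<ge>0. Vector_Spaces.linear scl scl (T t) \<and> continuous_on UNIV (T t)) \<and>
     T 0 = id \<and>
     (\<forall>s\<ge>0. \<forall>t\<ge>0. T (s + t) = T s \<circ> T t) \<and>
     (\<forall>x. continuous_on {0..} (\<lambda>t. T t x))"

text \<open>The generator as a partial operator, given by its graph.\<close>

definition generator_graph ::
  "('k::real_normed_field \<Rightarrow> 'x \<Rightarrow> 'x::{ab_group_add, topological_space}) \<Rightarrow> (real \<Rightarrow> 'x \<Rightarrow> 'x) \<Rightarrow> ('x \<times> 'x) set"
  where
  "generator_graph scl T =
     {(x, y). ((\<lambda>t. scl (of_real (1 / t)) (T t x - x)) \<longlongrightarrow> y) (at_right 0)}"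

text \<open>An everywhere defined operator \<open>A\<close> is the generator iff the two graphs coincide.\<close>

definition generates_semigroup ::
  "('k::real_normed_field \<Rightarrow> 'x \<Rightarrow> 'x::{ab_group_add, topological_space}) \<Rightarrow> ('x \<Rightarrow> 'x) \<Rightarrow> bool"
  where
  "generates_semigroup scl A \<longleftrightarrow>
     (\<exists>T. strongly_continuous_semigroup scl T \<and> generator_graph scl T = {(x, A x) | x. True})"

text \<open>The set \<open>\<real>\<^sub>\<ge>\<^sub>0\<close> is the image of \<open>{0..}\<close> under \<open>of_real\<close>.\<close>

definition quasiadjacency_matrix ::
  "('v \<times> 'v) set \<Rightarrow> (nat \<Rightarrow> 'v) \<Rightarrow> (nat \<Rightarrow> nat \<Rightarrow> 'k::real_normed_field) \<Rightarrow> bool"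
  where
  "quasiadjacency_matrix E v B \<longleftrightarrow>
     (\<exists>c. c \<noteq> 0 \<and> (\<forall>k l. c * B k l \<in> \<real>\<^sub>\<ge>\<^sub>0)) \<and>
     (\<forall>k l. B k l \<noteq> 0 \<longleftrightarrow> (v k, v l) \<in> E)"

text \<open>The sum over all \<open>l\<close>, restricted to the support of the \<open>k\<close>-th row; it has its intended
  meaning when the rows of \<open>B\<close> are finitely supported.\<close>

definition matrix_action :: "(nat \<Rightarrow> nat \<Rightarrow> 'k::field) \<Rightarrow> (nat \<Rightarrow> 'k) \<Rightarrow> (nat \<Rightarrow> 'k)" where
  "matrix_action B f = (\<lambda>k. \<Sum>l | B k l \<noteq> 0. B k l * f l)"

definition graph_laplacian ::
  "('v \<times> 'v) set \<Rightarrow> ('v \<Rightarrow> 'v \<Rightarrow> real) \<Rightarrow> ('v \<Rightarrow> 'k::real_normed_field) \<Rightarrow> ('v \<Rightarrow> 'k)"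
  where
  "graph_laplacian E \<gamma> f = (\<lambda>x. \<Sum>y | (x, y) \<in> E. of_real (\<gamma> x y) * (f x - f y))"

lemma linear_matrix_operator:
  fixes lam :: "'k::real_normed_field"
  shows "Vector_Spaces.linear fun_scale fun_scale (\<lambda>f. fun_scale lam f - matrix_action B f)"
  using vector_space_fun_scale
  by (auto simp: Vector_Spaces.linear_iff fun_eq_iff fun_scale_def matrix_action_def
      algebra_simps sum.distrib sum_distrib_left)

lemma continuous_matrix_operator:
  fixes lam :: "'k::real_normed_field"
  shows "continuous_on UNIV (\<lambda>f. fun_scale lam f - matrix_action B f)"
  unfolding fun_scale_def matrix_action_def fun_diff_def
  by (intro continuous_intros continuous_on_coordinatewise_then_product
      continuous_on_product_coordinates)

end

theory Submission
  imports Defs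
begin

text \<open>
  The obstruction is a mismatch between finiteness and propagation. Suppose that \<open>A\<close> generates a
  strongly continuous semigroup \<open>T\<close> on a product \<open>\<^bold>K\<^sup>I\<close> of copies of the scalar field, and fix a
  coordinate \<open>k\<close>. For \<open>t \<in> [0, 1]\<close> the maps \<open>x \<mapsto> (T t x) k\<close> are continuous linear functionals, and
  they are pointwise bounded since orbits are continuous. The dual of \<open>\<^bold>K\<^sup>I\<close> consists of finitely
  supported families, and a pointwise bounded set in it lives on one common finite set \<open>S\<close> of
  coordinates (\<open>pointwise_bounded_functionals_finite_support\<close>). Hence, if \<open>l\<close> lies outside \<open>S\<close>, then
  \<open>(T t (unit_vec l)) k = 0\<close> for all \<open>t \<in> [0, 1]\<close>. Right derivatives turn this into
  \<open>(T t (A\<^sup>n (unit_vec l))) k = 0\<close> on \<open>[0, 1)\<close>, and \<open>t = 0\<close> shows that the \<open>k\<close>-th rows of all the powers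
  of \<open>A\<close> are supported in \<open>S\<close> (\<open>generator_powers_finite_rows\<close>).

  On the other hand, let \<open>A\<close> be a diagonal matrix minus a matrix \<open>B\<close> whose nonzero entries sit on the
  edges of a connected graph and all lie on one ray of the scalar field. If \<open>n\<close> is the
  distance from \<open>k\<close> to \<open>l\<close>, then only the walks that follow an edge in each of their \<open>n\<close> steps contribute
  to the entry of \<open>A\<^sup>n\<close> at \<open>(k, l)\<close>, and their contributions, lying on a common ray, cannot cancel
  (\<open>power_entry_at_distance\<close>). So every \<open>l\<close> belongs to \<open>S\<close>, which is impossible in an
  infinite graph. Since the diagonal is arbitrary, quasiadjacency matrices and graph Laplacians are
  covered at the same time.
\<close>

section \<open>Continuous linear functionals on a product of copies of the scalar field\<close>

definition unit_vec :: "'i \<Rightarrow> 'i \<Rightarrow> 'k::field" where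
  "unit_vec i = (\<lambda>j. if j = i then 1 else 0)"

text \<open>
  A basic neighbourhood of \<open>0\<close> on which \<open>y\<close> is bounded by \<open>1\<close> restricts only finitely many coordinates.
  It contains the whole line through any \<open>x\<close> that vanishes there, and a linear functional that is
  bounded on a line is zero on it.
\<close>

lemma functional_finitely_determined:
  fixes y :: "('i \<Rightarrow> 'k::real_normed_field) \<Rightarrow> 'k"
  assumes lin: "Vector_Spaces.linear fun_scale (*) y" and cont: "continuous_on UNIV y"
  shows "\<exists>S. finite S \<and> (\<forall>x. (\<forall>i\<in>S. x i = 0) \<longrightarrow> y x = 0)"
proof -
  interpret y: Vector_Spaces.linear fun_scale "(*)" y by (rule lin)
  have "open (y -` ball 0 1)" using cont by (simp add: continuous_on_open_vimage)
  then have "openin (product_topology (\<lambda>i. euclidean) UNIV) (y -` ball 0 1)"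
    by (simp add: open_fun_def)
  moreover have "0 \<in> y -` ball 0 1" by (simp add: y.zero)
  ultimately obtain U where U: "finite {i. U i \<noteq> UNIV}" "0 \<in> Pi\<^sub>E UNIV U" "Pi\<^sub>E UNIV U \<subseteq> y -` ball 0 1"
    using product_topology_open_contains_basis[of "\<lambda>i. euclidean" UNIV "y -` ball 0 1" 0] by auto
  have "y x = 0" if x: "\<forall>i\<in>{i. U i \<noteq> UNIV}. x i = 0" for x
  proof (rule ccontr)
    assume nz: "y x \<noteq> 0"
    \<comment> \<open>Scaled by \<open>c\<close>, the vector \<open>x\<close> has value exactly \<open>1\<close>, yet it stays in the neighbourhood.\<close>
    define c where "c = inverse (y x)"
    have "fun_scale c x \<in> Pi\<^sub>E UNIV U"
      using x U(2) by (force simp: PiE_iff fun_scale_def)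
    with U(3) have "norm (y (fun_scale c x)) < 1" by auto
    then show False using nz by (simp add: y.scale c_def)
  qed
  with U(1) show ?thesis by blast
qed

lemma functional_finite_support:
  fixes y :: "('i \<Rightarrow> 'k::real_normed_field) \<Rightarrow> 'k"
  assumes lin: "Vector_Spaces.linear fun_scale (*) y" and cont: "continuous_on UNIV y"
  shows "finite {i. y (unit_vec i) \<noteq> 0}"
proof -
  obtain S where S: "finite S" "\<And>x. (\<forall>i\<in>S. x i = 0) \<Longrightarrow> y x = 0"
    using functional_finitely_determined[OF lin cont] by auto
  have "y (unit_vec i) = 0" if "i \<notin> S" for i
    using that by (intro S(2)) (auto simp: unit_vec_def)
  then have "{i. y (unit_vec i) \<noteq> 0} \<subseteq> S" by blast
  then show ?thesis using S(1) by (rule finite_subset)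
qed

lemma functional_expansion:
  fixes y :: "('i \<Rightarrow> 'k::real_normed_field) \<Rightarrow> 'k"
  assumes lin: "Vector_Spaces.linear fun_scale (*) y" and cont: "continuous_on UNIV y"
    and fin: "finite P" and outside: "\<And>i. i \<notin> P \<Longrightarrow> x i * y (unit_vec i) = 0"
  shows "y x = (\<Sum>i\<in>P. x i * y (unit_vec i))"
proof -
  interpret y: Vector_Spaces.linear fun_scale "(*)" y by (rule lin)
  obtain S where S: "finite S" "\<And>x. (\<forall>i\<in>S. x i = 0) \<Longrightarrow> y x = 0"
    using functional_finitely_determined[OF lin cont] by auto
  define p where "p = (\<Sum>i\<in>S. fun_scale (x i) (unit_vec i))"
  have sum_apply: "sum f F i = (\<Sum>j\<in>F. f j i)" if "finite F" for f :: "'i \<Rightarrow> 'i \<Rightarrow> 'k" and F i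
    using that by (induction F) auto
  have "p i = x i" if "i \<in> S" for i
    using S(1) that by (simp add: p_def sum_apply fun_scale_def unit_vec_def if_distrib cong: if_cong)
  then have "y (x - p) = 0" by (intro S(2)) simp
  then have "y x = y p" by (simp add: y.diff)
  also have "\<dots> = (\<Sum>i\<in>S. x i * y (unit_vec i))" by (simp add: p_def y.sum y.scale)
  also have "\<dots> = (\<Sum>i\<in>P. x i * y (unit_vec i))"
  proof -
    have "y (unit_vec i) = 0" if "i \<notin> S" for i
      using that by (intro S(2)) (auto simp: unit_vec_def)
    then have "(\<Sum>i\<in>S. x i * y (unit_vec i)) = (\<Sum>i\<in>S \<union> P. x i * y (unit_vec i))"
      using S(1) fin by (intro sum.mono_neutral_left) auto
    also have "\<dots> = (\<Sum>i\<in>P. x i * y (unit_vec i))"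
      using S(1) fin outside by (intro sum.mono_neutral_right) auto
    finally show ?thesis .
  qed
  finally show ?thesis .
qed

section \<open>Pointwise bounded sets of functionals\<close>

text \<open>
  The solution \<open>a\<close> of the lower triangular system \<open>\<Sum>m\<le>l. a m * z l m = of_nat l\<close>, computed row by row. A
  row with \<open>z l l = 0\<close> receives the default value \<open>0\<close> of division.
\<close>

fun forward_substitution :: "(nat \<Rightarrow> nat \<Rightarrow> 'k::field) \<Rightarrow> nat \<Rightarrow> 'k" where
  "forward_substitution z l =
     (of_nat l - (\<Sum>m<l. forward_substitution z m * z l m)) / z l l"

declare forward_substitution.simps [simp del]

lemma forward_substitution_solves:
  assumes "z l l \<noteq> 0"
  shows "(\<Sum>m\<le>l. forward_substitution z m * z l m) = of_nat l"
proof -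
  have "(\<Sum>m\<le>l. forward_substitution z m * z l m) =
      (\<Sum>m<l. forward_substitution z m * z l m) + forward_substitution z l * z l l"
    by (simp add: lessThan_Suc_atMost[symmetric])
  also have "forward_substitution z l * z l l =
      of_nat l - (\<Sum>m<l. forward_substitution z m * z l m)"
    using assms by (subst forward_substitution.simps) simp
  finally show ?thesis by simp
qed

text \<open>
  A gliding hump argument. If infinitely many coordinates were charged by \<open>F\<close>, then along a sequence
  \<open>u\<close> of them some functionals in \<open>F\<close> would have arbitrarily large last charged index \<open>l\<close>. Choosing one
  functional for each such \<open>l\<close> gives a triangular system, so a single vector \<open>x\<close> can be built on which
  the functional belonging to \<open>l\<close> takes the value \<open>l\<close>. This contradicts boundedness at \<open>x\<close>.
\<close>

lemma pointwise_bounded_functionals_finite_support: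
  fixes F :: "(('i \<Rightarrow> 'k::real_normed_field) \<Rightarrow> 'k) set"
  assumes lin: "\<And>y. y \<in> F \<Longrightarrow> Vector_Spaces.linear fun_scale (*) y"
    and cont: "\<And>y. y \<in> F \<Longrightarrow> continuous_on UNIV y"
    and bdd: "\<And>x. bounded ((\<lambda>y. y x) ` F)"
  shows "finite {i. \<exists>y\<in>F. y (unit_vec i) \<noteq> 0}" (is "finite ?M")
proof (rule ccontr)
  assume "infinite ?M"
  then obtain u :: "nat \<Rightarrow> 'i" where u: "inj u" "range u \<subseteq> ?M"
    by (meson infinite_countable_subset)
  then have "\<forall>n. \<exists>y\<in>F. y (unit_vec (u n)) \<noteq> 0" by auto
  then obtain f where f: "\<And>n. f n \<in> F" "\<And>n. f n (unit_vec (u n)) \<noteq> 0" by metis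
  define S where "S n = {m. f n (unit_vec (u m)) \<noteq> 0}" for n
  have finS: "finite (S n)" for n
    using finite_vimageI[OF functional_finite_support[OF lin cont, OF f(1) f(1)] u(1)]
    by (simp add: S_def vimage_def)
  have nS: "n \<in> S n" for n using f(2) by (simp add: S_def)
  define g where "g n = Max (S n)" for n
  have g_ge: "n \<le> g n" for n using finS nS by (simp add: g_def)
  have g_in: "g n \<in> S n" for n using finS nS by (auto simp: g_def intro!: Max_in)
  have above_g: "m \<le> g n" if "m \<in> S n" for m n using finS that by (simp add: g_def)
  \<comment> \<open>Different \<open>n\<close> may share the last index \<open>l\<close>; the system needs one functional for each \<open>l\<close>.\<close>
  define h where "h l = (SOME n. g n = l)" for l
  have gh: "g (h (g n)) = g n" for n unfolding h_def by (rule someI) simp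
  define z where "z l m = f (h l) (unit_vec (u m))" for l m
  define x where
    "x i = (if i \<in> range u then forward_substitution z (inv u i) else 0)" for i
  have xu: "x (u m) = forward_substitution z m" for m
    using u(1) by (simp add: x_def)
  have fx: "f (h (g n)) x = of_nat (g n)" for n
  proof -
    define l where "l = g n"
    have "f (h l) x = (\<Sum>i\<in>u ` {..l}. x i * f (h l) (unit_vec i))"
    proof (rule functional_expansion[OF lin cont])
      fix i assume i: "i \<notin> u ` {..l}"
      show "x i * f (h l) (unit_vec i) = 0"
      proof (cases "i \<in> range u")
        case True
        then obtain m where m: "i = u m" by auto
        with i have "l < m" by auto
        then have "m \<notin> S (h l)" using above_g[of m "h l"] gh[of n] by (auto simp: l_def)
        then show ?thesis by (simp add: S_def m)
      qed (simp add: x_def)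
    qed (use f(1) in auto)
    also have "\<dots> = (\<Sum>m\<le>l. forward_substitution z m * z l m)"
      using u(1) by (subst sum.reindex) (auto simp: xu z_def inj_on_def)
    also have "\<dots> = of_nat l"
      using g_in[of "h l"] gh[of n]
      by (intro forward_substitution_solves) (simp add: z_def S_def l_def)
    finally show ?thesis by (simp add: l_def)
  qed
  obtain C where C: "\<And>y. y \<in> F \<Longrightarrow> norm (y x) \<le> C"
    using bdd[of x] by (auto simp: bounded_iff)
  obtain n :: nat where "C < of_nat n" using reals_Archimedean2 by blast
  also have "\<dots> \<le> real (g n)" using g_ge by simp
  also have "\<dots> = norm (f (h (g n)) x)" by (simp add: fx)
  also have "\<dots> \<le> C" using C f(1) by blast
  finally show False by simp
qed

section \<open>Rows of the powers of a generator\<close>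

text \<open>
  The proof works with the semigroup at the times \<open>t \<in> [0, 1)\<close> rather than at \<open>0\<close> alone: that a
  coordinate of the orbit of \<open>x\<close> vanishes on a whole interval is a property that passes from \<open>x\<close> to
  \<open>A x\<close>, so it can be iterated.
\<close>

lemma generator_powers_finite_rows:
  fixes A :: "('i \<Rightarrow> 'k::real_normed_field) \<Rightarrow> 'i \<Rightarrow> 'k"
  assumes gen: "generates_semigroup fun_scale A"
  shows "finite {l. \<exists>n. (A ^^ n) (unit_vec l) k \<noteq> 0}"
proof -
  obtain T where T: "strongly_continuous_semigroup fun_scale T"
    and graph: "generator_graph fun_scale T = {(x, A x) | x. True}"
    using gen by (auto simp: generates_semigroup_def)
  have lin: "Vector_Spaces.linear fun_scale fun_scale (T t)"
    and cont: "continuous_on UNIV (T t)" if "t \<ge> 0" for t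
    using T that by (auto simp: strongly_continuous_semigroup_def)
  have T0: "T 0 = id" and Tadd: "\<And>s t. s \<ge> 0 \<Longrightarrow> t \<ge> 0 \<Longrightarrow> T (s + t) x = T s (T t x)"
    and orbit: "continuous_on {0..} (\<lambda>t. T t x)" for x
    using T by (auto simp: strongly_continuous_semigroup_def)
  have A: "((\<lambda>t. fun_scale (of_real (1 / t)) (T t x - x)) \<longlongrightarrow> A x) (at_right 0)" for x
    using graph by (auto simp: generator_graph_def set_eq_iff)
  define F where "F = (\<lambda>t x. T t x k) ` {0..1}"
  have "finite {l. \<exists>y\<in>F. y (unit_vec l) \<noteq> 0}"
  proof (rule pointwise_bounded_functionals_finite_support)
    fix y assume "y \<in> F"
    then obtain t where t: "0 \<le> t" "y = (\<lambda>x. T t x k)" by (auto simp: F_def)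
    show "Vector_Spaces.linear fun_scale (*) y"
      using lin[OF t(1)] unfolding Vector_Spaces.linear_iff t(2)
      by (auto simp: fun_scale_def vector_space_def algebra_simps)
    show "continuous_on UNIV y"
      unfolding t(2) using cont[OF t(1)] by (rule continuous_on_product_then_coordinatewise)
  next
    fix x
    have "continuous_on {0..1} (\<lambda>t. T t x k)"
      by (rule continuous_on_product_then_coordinatewise, rule continuous_on_subset[OF orbit]) auto
    then have "bounded ((\<lambda>t. T t x k) ` {0..1})"
      by (intro compact_imp_bounded compact_continuous_image) auto
    then show "bounded ((\<lambda>y. y x) ` F)" by (simp add: F_def image_image)
  qed
  moreover have "{l. \<exists>n. (A ^^ n) (unit_vec l) k \<noteq> 0} \<subseteq> {l. \<exists>y\<in>F. y (unit_vec l) \<noteq> 0}"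
  proof (rule subsetI, rule ccontr)
    fix l assume l: "l \<in> {l. \<exists>n. (A ^^ n) (unit_vec l) k \<noteq> 0}"
      and "l \<notin> {l. \<exists>y\<in>F. y (unit_vec l) \<noteq> 0}"
    then have vanish: "T t (unit_vec l) k = 0" if "0 \<le> t" "t \<le> 1" for t
      using that by (auto simp: F_def)
    \<comment> \<open>\<open>T t (A x)\<close> is the right derivative of the orbit of \<open>x\<close> at \<open>t\<close>; the times \<open>t + h\<close> have to stay
      below \<open>1\<close>, hence the half-open interval.\<close>
    have step: "T t (A x) k = 0"
      if zero: "\<And>t. 0 \<le> t \<Longrightarrow> t < 1 \<Longrightarrow> T t x k = 0" and t: "0 \<le> t" "t < 1" for x t
    proof -
      interpret Tt: Vector_Spaces.linear fun_scale fun_scale "T t" using lin t(1) .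
      have "((\<lambda>h. T t (fun_scale (of_real (1 / h)) (T h x - x)) k) \<longlongrightarrow> T t (A x) k) (at_right 0)"
      proof (rule tendsto_compose[OF _ A, of "\<lambda>z. T t z k"])
        have "continuous_on UNIV (\<lambda>z. T t z k)"
          using cont[OF t(1)] by (rule continuous_on_product_then_coordinatewise)
        then show "((\<lambda>z. T t z k) \<longlongrightarrow> T t (A x) k) (at (A x))"
          by (simp add: continuous_on_def)
      qed
      moreover have "\<forall>\<^sub>F h in at_right 0. T t (fun_scale (of_real (1 / h)) (T h x - x)) k = 0"
      proof (rule eventually_mono)
        show "\<forall>\<^sub>F h in at_right 0. h \<in> {0<..<1 - t}"
          using t by (intro eventually_at_right_real) simp
        fix h :: real assume "h \<in> {0<..<1 - t}"
        then have h: "0 \<le> h" "t + h < 1" by auto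
        have "T t (fun_scale (of_real (1 / h)) (T h x - x)) k
            = of_real (1 / h) * (T (t + h) x k - T t x k)"
          unfolding Tt.scale Tt.diff Tadd[OF t(1) h(1)] by (simp add: fun_scale_def)
        then show "T t (fun_scale (of_real (1 / h)) (T h x - x)) k = 0"
          using t h by (simp add: zero)
      qed
      ultimately show ?thesis
        by (rule tendsto_unique[OF trivial_limit_at_right_real _ tendsto_eventually])
    qed
    have "T t ((A ^^ n) (unit_vec l)) k = 0" if "0 \<le> t" "t < 1" for n t
      using that
    proof (induction n arbitrary: t)
      case (Suc n)
      then show ?case by (auto intro: step)
    qed (auto intro: vanish)
    from this[of 0] have "(A ^^ n) (unit_vec l) k = 0" for n by (simp add: T0)
    with l show False by simp
  qed
  ultimately show ?thesis by (rule rev_finite_subset)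
qed

section \<open>Matrices supported on the edges of a graph\<close>

definition diag_minus :: "('i \<Rightarrow> 'k::field) \<Rightarrow> ('i \<Rightarrow> 'i \<Rightarrow> 'k) \<Rightarrow> ('i \<Rightarrow> 'k) \<Rightarrow> 'i \<Rightarrow> 'k" where
  "diag_minus d B f = (\<lambda>k. d k * f k - (\<Sum>l | B k l \<noteq> 0. B k l * f l))"

lemma sum_nonneg_Reals:
  fixes f :: "'i \<Rightarrow> 'k::real_normed_field"
  assumes fin: "finite S" and nonneg: "\<And>i. i \<in> S \<Longrightarrow> f i \<in> \<real>\<^sub>\<ge>\<^sub>0"
  shows "sum f S \<in> \<real>\<^sub>\<ge>\<^sub>0 \<and> (sum f S = 0 \<longleftrightarrow> (\<forall>i\<in>S. f i = 0))"
proof -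
  have "\<forall>i\<in>S. \<exists>r. f i = of_real r \<and> r \<ge> 0"
    using nonneg by (auto simp: nonneg_Reals_def)
  then obtain r where r: "\<And>i. i \<in> S \<Longrightarrow> f i = of_real (r i)" "\<And>i. i \<in> S \<Longrightarrow> r i \<ge> 0"
    by metis
  have s: "sum f S = of_real (sum r S)" using r(1) by simp
  have "sum r S \<ge> 0" using r(2) by (simp add: sum_nonneg)
  then have "sum f S \<in> \<real>\<^sub>\<ge>\<^sub>0" unfolding s nonneg_Reals_def by blast
  moreover have "sum f S = 0 \<longleftrightarrow> (\<forall>i\<in>S. f i = 0)"
    unfolding s of_real_eq_0_iff using r fin by (simp add: sum_nonneg_eq_0_iff)
  ultimately show ?thesis by simp
qed

text \<open>
  Up to the factor \<open>(- c) ^ n\<close>, the entry is the sum over all walks of length \<open>n\<close> from \<open>k\<close> to \<open>w\<close> of the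
  products of the nonnegative numbers \<open>c * B i j\<close>, hence it vanishes only if there is no such walk. A
  product with a factor from the diagonal would leave fewer than \<open>n\<close> steps to get from \<open>k\<close> to \<open>w\<close>. In
  the induction step the same hypothesis holds for the out-neighbours \<open>l\<close> of \<open>k\<close> with \<open>n\<close> in place of
  \<open>Suc n\<close>, because a shorter walk from \<open>l\<close> would extend to a too short one from \<open>k\<close>.
\<close>

lemma power_entry_at_distance:
  fixes B :: "'i \<Rightarrow> 'i \<Rightarrow> 'k::real_normed_field"
  defines "R \<equiv> {(k, l). B k l \<noteq> 0}"
  assumes rows: "\<And>k. finite {l. B k l \<noteq> 0}"
    and c: "c \<noteq> 0" "\<And>k l. c * B k l \<in> \<real>\<^sub>\<ge>\<^sub>0"
    and far: "\<And>m. m < n \<Longrightarrow> (k, w) \<notin> R ^^ m"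
  shows "(- c) ^ n * (diag_minus d B ^^ n) (unit_vec w) k \<in> \<real>\<^sub>\<ge>\<^sub>0 \<and>
         ((diag_minus d B ^^ n) (unit_vec w) k \<noteq> 0 \<longleftrightarrow> (k, w) \<in> R ^^ n)"
  using far
proof (induction n arbitrary: k)
  case 0
  then show ?case by (auto simp: unit_vec_def)
next
  case (Suc n)
  define x where "x = (diag_minus d B ^^ n) (unit_vec w)"
  have "x k = 0" using Suc.IH[of k] Suc.prems by (simp add: x_def)
  then have Ax: "diag_minus d B x k = - (\<Sum>l | B k l \<noteq> 0. B k l * x l)" by (simp add: diag_minus_def)
  have IH: "(- c) ^ n * x l \<in> \<real>\<^sub>\<ge>\<^sub>0 \<and> (x l \<noteq> 0 \<longleftrightarrow> (l, w) \<in> R ^^ n)" if "B k l \<noteq> 0" for l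
    unfolding x_def
  proof (rule Suc.IH)
    fix m assume "m < n"
    show "(l, w) \<notin> R ^^ m"
    proof
      assume "(l, w) \<in> R ^^ m"
      then have "(k, w) \<in> R ^^ Suc m"
        using that by (intro relpow_Suc_I2[of k l]) (auto simp: R_def)
      then show False using Suc.prems[of "Suc m"] \<open>m < n\<close> by simp
    qed
  qed
  let ?s = "\<Sum>l | B k l \<noteq> 0. (c * B k l) * ((- c) ^ n * x l)"
  have eq: "(- c) ^ Suc n * diag_minus d B x k = ?s"
    by (simp add: Ax sum_distrib_left sum_negf mult_ac)
  have s: "?s \<in> \<real>\<^sub>\<ge>\<^sub>0 \<and> (?s = 0 \<longleftrightarrow> (\<forall>l\<in>{l. B k l \<noteq> 0}. (c * B k l) * ((- c) ^ n * x l) = 0))"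
  proof (rule sum_nonneg_Reals)
    fix l assume "l \<in> {l. B k l \<noteq> 0}"
    then show "(c * B k l) * ((- c) ^ n * x l) \<in> \<real>\<^sub>\<ge>\<^sub>0"
      using IH by (intro nonneg_Reals_mult_I[OF c(2)]) simp
  qed (rule rows)
  have "diag_minus d B x k \<noteq> 0 \<longleftrightarrow> ?s \<noteq> 0" unfolding eq[symmetric] using c(1) by simp
  also have "\<dots> \<longleftrightarrow> (\<exists>l. B k l \<noteq> 0 \<and> x l \<noteq> 0)" using s c(1) by auto
  also have "\<dots> \<longleftrightarrow> (\<exists>l. (k, l) \<in> R \<and> (l, w) \<in> R ^^ n)" using IH by (auto simp: R_def)
  also have "\<dots> \<longleftrightarrow> (k, w) \<in> R ^^ Suc n"
    by (metis relpow_Suc_I2 relpow_Suc_E2)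
  finally show ?case using s eq by (simp add: x_def)
qed

text \<open>
  The finitely many coordinates that the \<open>k\<close>-th rows of the powers can reach miss some vertex \<open>w\<close>, whereas
  the power at the distance from \<open>k\<close> to \<open>w\<close> does reach \<open>w\<close>.
\<close>

lemma no_semigroup_of_connected_matrix:
  fixes B :: "'i \<Rightarrow> 'i \<Rightarrow> 'k::real_normed_field"
  assumes inf: "infinite (UNIV :: 'i set)"
    and rows: "\<And>k. finite {l. B k l \<noteq> 0}"
    and c: "c \<noteq> 0" "\<And>k l. c * B k l \<in> \<real>\<^sub>\<ge>\<^sub>0"
    and conn: "\<And>k l. (k, l) \<in> {(k, l). B k l \<noteq> 0}\<^sup>*"
  shows "\<not> generates_semigroup fun_scale (diag_minus d B)"
proof
  let ?R = "{(k, l). B k l \<noteq> 0}"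
  fix k :: 'i
  assume "generates_semigroup fun_scale (diag_minus d B)"
  then have "finite {l. \<exists>n. (diag_minus d B ^^ n) (unit_vec l) k \<noteq> 0}"
    by (rule generator_powers_finite_rows)
  then obtain w where w: "\<And>n. (diag_minus d B ^^ n) (unit_vec w) k = 0"
    using inf ex_new_if_finite by blast
  define n where "n = (LEAST n. (k, w) \<in> ?R ^^ n)"
  have "\<exists>n. (k, w) \<in> ?R ^^ n" using conn[of k w] by (simp only: rtrancl_power)
  then have "(k, w) \<in> ?R ^^ n" unfolding n_def by (rule LeastI_ex)
  moreover have "(k, w) \<notin> ?R ^^ m" if "m < n" for m
    using that unfolding n_def by (rule not_less_Least)
  ultimately have "(diag_minus d B ^^ n) (unit_vec w) k \<noteq> 0"
    using power_entry_at_distance[OF rows c] by simp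
  with w show False by simp
qed

section \<open>Quasiadjacency matrices and graph Laplacians\<close>

lemma no_semigroup_of_quasiadjacency_matrix:
  fixes E :: "('v \<times> 'v) set" and v :: "nat \<Rightarrow> 'v" and lam :: "'k::real_normed_field"
  assumes locally_finite: "\<And>x. finite {y. (x, y) \<in> E}"
    and connected: "\<And>x y. x \<noteq> y \<Longrightarrow> (x, y) \<in> E\<^sup>*"
    and enumeration: "bij v"
    and B: "quasiadjacency_matrix E v B"
  shows "\<not> generates_semigroup fun_scale (\<lambda>f. fun_scale lam f - matrix_action B f)"
proof -
  obtain c where c: "c \<noteq> 0" "\<And>k l. c * B k l \<in> \<real>\<^sub>\<ge>\<^sub>0"
    and BE: "\<And>k l. B k l \<noteq> 0 \<longleftrightarrow> (v k, v l) \<in> E"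
    using B by (auto simp: quasiadjacency_matrix_def)
  have "finite {l. B k l \<noteq> 0}" for k
    using finite_vimageI[OF locally_finite[of "v k"] bij_is_inj[OF enumeration]]
    by (simp add: BE vimage_def)
  moreover have "(k, l) \<in> {(k, l). B k l \<noteq> 0}\<^sup>*" for k l
  proof -
    have "(inv v x, inv v y) \<in> {(k, l). B k l \<noteq> 0}\<^sup>*" if "(x, y) \<in> E\<^sup>*" for x y
      using that
    proof induction
      case (step y z)
      then have "(inv v y, inv v z) \<in> {(k, l). B k l \<noteq> 0}"
        using enumeration by (simp add: BE bij_is_surj surj_f_inv_f)
      with step.IH show ?case by (rule rtrancl_into_rtrancl)
    qed simp
    moreover have "(v k, v l) \<in> E\<^sup>*" using connected by (cases "v k = v l") auto
    ultimately have "(inv v (v k), inv v (v l)) \<in> {(k, l). B k l \<noteq> 0}\<^sup>*" by blast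
    then show ?thesis using enumeration by (simp only: bij_is_inj inv_f_f)
  qed
  ultimately have "\<not> generates_semigroup fun_scale (diag_minus (\<lambda>_. lam) B)"
    using c by (intro no_semigroup_of_connected_matrix) auto
  moreover have "diag_minus (\<lambda>_. lam) B = (\<lambda>f. fun_scale lam f - matrix_action B f)"
    by (simp add: fun_eq_iff diag_minus_def fun_scale_def matrix_action_def)
  ultimately show ?thesis by simp
qed

text \<open>
  The terms \<open>f x\<close> of the Laplacian go into the diagonal together with \<open>\<alpha>\<close>. What remains is the matrix with
  entries \<open>\<beta> * \<gamma> x y\<close> on the edges, all on the ray through \<open>\<beta>\<close>.
\<close>

lemma no_semigroup_of_graph_laplacian:
  fixes E :: "('v \<times> 'v) set" and \<gamma> :: "'v \<Rightarrow> 'v \<Rightarrow> real" and \<alpha> \<beta> :: "'k::real_normed_field"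
  assumes inf: "infinite (UNIV :: 'v set)"
    and locally_finite: "\<And>x. finite {y. (x, y) \<in> E}"
    and connected: "\<And>x y. x \<noteq> y \<Longrightarrow> (x, y) \<in> E\<^sup>*"
    and \<gamma>: "\<And>x y. (x, y) \<in> E \<Longrightarrow> \<gamma> x y > 0" and \<beta>: "\<beta> \<noteq> 0"
  shows "\<not> generates_semigroup fun_scale
           (\<lambda>f. fun_scale \<alpha> f + fun_scale \<beta> (graph_laplacian E \<gamma> f))"
proof -
  define B where "B x y = (if (x, y) \<in> E then \<beta> * of_real (\<gamma> x y) else 0)" for x y
  define d where "d x = \<alpha> + \<beta> * (\<Sum>y | (x, y) \<in> E. of_real (\<gamma> x y))" for x
  have BE: "B x y \<noteq> 0 \<longleftrightarrow> (x, y) \<in> E" for x y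
    using \<gamma>[of x y] \<beta> by (auto simp: B_def)
  have "inverse \<beta> * B x y \<in> \<real>\<^sub>\<ge>\<^sub>0" for x y
    using \<gamma>[of x y] \<beta> by (auto simp: B_def mult.assoc[symmetric] less_imp_le)
  moreover have "(x, y) \<in> {(x, y). B x y \<noteq> 0}\<^sup>*" for x y
    using connected by (cases "x = y") (auto simp: BE)
  ultimately have "\<not> generates_semigroup fun_scale (diag_minus d B)"
    using inf locally_finite \<beta> BE
    by (intro no_semigroup_of_connected_matrix[where c = "inverse \<beta>"]) auto
  moreover have "diag_minus d B =
      (\<lambda>f. fun_scale \<alpha> f + fun_scale \<beta> (graph_laplacian E \<gamma> f))"
  proof (intro ext)
    fix f x
    have "(\<Sum>y | B x y \<noteq> 0. B x y * f y) = (\<Sum>y | (x, y) \<in> E. \<beta> * of_real (\<gamma> x y) * f y)"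
      unfolding BE by (rule sum.cong) (auto simp: B_def)
    then show "diag_minus d B f x =
        (fun_scale \<alpha> f + fun_scale \<beta> (graph_laplacian E \<gamma> f)) x"
      by (simp add: diag_minus_def d_def fun_scale_def graph_laplacian_def algebra_simps
          sum_distrib_left sum_distrib_right sum_subtractf)
  qed
  ultimately show ?thesis by simp
qed

theorem theorem1:
  fixes E :: "('v \<times> 'v) set" and v :: "nat \<Rightarrow> 'v"
  assumes undirected: "sym E"
    and loopfree: "irrefl E"
    and locally_finite: "\<And>x. finite {y. (x, y) \<in> E}"
    and connected: "\<And>x y. x \<noteq> y \<Longrightarrow> (x, y) \<in> E\<^sup>*"
    and enumeration: "bij v"
  shows
    "((\<forall>(lam :: real) B. quasiadjacency_matrix E v B \<longrightarrow>
         \<not> generates_semigroup fun_scale (\<lambda>f. fun_scale lam f - matrix_action B f)) \<and>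
      (\<forall>(lam :: complex) B. quasiadjacency_matrix E v B \<longrightarrow>
         \<not> generates_semigroup fun_scale (\<lambda>f. fun_scale lam f - matrix_action B f))) \<and>
     (\<forall>\<gamma> :: 'v \<Rightarrow> 'v \<Rightarrow> real. (\<forall>x y. (x, y) \<in> E \<longrightarrow> \<gamma> x y > 0) \<longrightarrow>
       (\<forall>(\<alpha> :: real) \<beta>. \<beta> \<noteq> 0 \<longrightarrow>
         \<not> generates_semigroup fun_scale
           (\<lambda>f. fun_scale \<alpha> f + fun_scale \<beta> (graph_laplacian E \<gamma> f))) \<and>
       (\<forall>(\<alpha> :: complex) \<beta>. \<beta> \<noteq> 0 \<longrightarrow>
         \<not> generates_semigroup fun_scale
           (\<lambda>f. fun_scale \<alpha> f + fun_scale \<beta> (graph_laplacian E \<gamma> f))))"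
proof -
  have inf: "infinite (UNIV :: 'v set)"
    using bij_betw_finite[OF enumeration] by simp
  show ?thesis
    by (intro conjI allI impI
        no_semigroup_of_quasiadjacency_matrix[OF locally_finite connected enumeration]
        no_semigroup_of_graph_laplacian[OF inf locally_finite connected]) auto
qed

end
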